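(* Let $0<a<b$ be real numbers, let $\mathcal{I}=\{z\in\mathbb{C}:|z|\le a\}$ and $\mathcal{O}=\{z\in\mathbb{C}:|z|\ge b\}$, and let $k$ be a positive integer. Then the rational function $z\mapsto z^{-k}$ attains the infimum in $$Z_k(\mathcal{O},\mathcal{I})=\inf_{r\in\mathcal{R}_{k,k}}\frac{\sup_{z\in\mathcal{O}}|r(z)|}{\inf_{z\in\mathcal{I}}|r(z)|},$$ and this infimum equals $\left(\frac{a}{b}\right)^k$.
   Context: $\mathcal{R}_{n,m}$ denotes the set of rational functions $P(z)/Q(z)$ with complex polynomials $P,Q$, $\deg P\le n$, $\deg Q\le m$ (and $Q\not\equiv 0$). For disjoint regions $\mathcal{E},\mathcal{G}\subset\mathbb{C}$, Zolotarev's third problem is to find $Z_k(\mathcal{E},\mathcal{G})=\inf_{r\in\mathcal{R}_{k,k}}\frac{\sup_{z\in\mathcal{E}}|r(z)|}{\inf_{z\in\mathcal{G}}|r(z)|}$. Conventions: rational functions take values in $\mathbb{C}\cup\{\infty\}$, with $|r(z)|=+\infty$ at a pole $z$ of $r$ (with $r$ in lowest terms); the function $r\equiv 0$ is excluded; and the quotient is $+\infty$ if its numerator is $+\infty$ or its denominator is $0$. *)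

theory Defs
  imports
    "HOL-Analysis.Analysis"
    "HOL-Computational_Algebra.Computational_Algebra"
    "HOL-Computational_Algebra.Field_as_Ring"
begin

definition ratfuns :: "nat \<Rightarrow> nat \<Rightarrow> complex poly fract set" where
  "ratfuns n m =
     {Fraction_Field.Fract P Q | P Q. Q \<noteq> 0 \<and> degree P \<le> n \<and> degree Q \<le> m}"

text \<open>
  The modulus \<open>|r(z)|\<close> with values in \<open>[0, \<infinity>]\<close>. Since \<^const>\<open>quot_of_fract\<close> returns coprime
  numerator and denominator, the denominator vanishes at \<open>z\<close> precisely if \<open>z\<close> is a pole.
\<close>
definition ratfun_abs :: "complex poly fract \<Rightarrow> complex \<Rightarrow> ennreal" where
  "ratfun_abs r z =
     (let (p, q) = quot_of_fract r
      in if poly q z = 0 then \<infinity> else ennreal (cmod (poly p z / poly q z)))"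

text \<open>
  The case distinction is needed because \<^typ>\<open>ennreal\<close> has \<open>0 / 0 = 0\<close> and \<open>\<infinity> / \<infinity> = 0\<close>.
\<close>
definition zolotarev_quotient ::
  "complex set \<Rightarrow> complex set \<Rightarrow> complex poly fract \<Rightarrow> ennreal" where
  "zolotarev_quotient E G r =
     (let s = (SUP z\<in>E. ratfun_abs r z); i = (INF z\<in>G. ratfun_abs r z)
      in if s = \<infinity> \<or> i = 0 then \<infinity> else s / i)"

definition zolotarev :: "nat \<Rightarrow> complex set \<Rightarrow> complex set \<Rightarrow> ennreal" where
  "zolotarev k E G = (INF r\<in>ratfuns k k - {0}. zolotarev_quotient E G r)"

end

theory Submission
  imports Defs "HOL-Complex_Analysis.Complex_Analysis"
begin

text \<open>
  For \<open>p = c \<Prod>(z - x\<^sub>j)\<close> and \<open>\<rho> > 0\<close> let \<open>M \<rho> p = |c| \<Prod>max \<rho> |x\<^sub>j|\<close>, the geometric mean of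
  \<open>|p|\<close> on the circle \<open>|z| = \<rho>\<close> (Jensen). A bound \<open>|u| \<le> C |v|\<close> on that circle
  implies \<open>M \<rho> u \<le> C M \<rho> v\<close>: reflecting the zeros inside the circle to the outside does not
  change the modulus on the circle, and the maximum principle then applies to the quotient at \<open>0\<close>.

  If \<open>p / q\<close> has modulus at most \<open>s\<close> for \<open>|z| \<ge> b\<close> and at least \<open>i\<close> for \<open>|z| \<le> a\<close>, then
  \<open>i M a q \<le> M a p \<le> M b p \<le> s M b q \<le> s (b/a)\<^sup>k M a q\<close>, where \<open>k \<ge> deg q\<close>.
\<close>

section \<open>Jensen means and reflection of zeros\<close>

definition circle_mean :: "real \<Rightarrow> complex poly \<Rightarrow> real" where
  "circle_mean \<rho> p = cmod (lead_coeff p) * (\<Prod>x\<in>#proots p. max \<rho> (cmod x))"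

text \<open>For \<open>cmod x < \<rho>\<close> this is \<open>z - x\<close> divided by the Blaschke
  factor of the disc: the zero \<open>x\<close> moves to its mirror image in the circle, or
  disappears if \<open>x = 0\<close>.\<close>

definition reflect_factor :: "real \<Rightarrow> complex \<Rightarrow> complex poly" where
  "reflect_factor \<rho> x =
     (if cmod x < \<rho> then [:of_real \<rho>, - cnj x / of_real \<rho>:] else [:- x, 1:])"

definition reflect_roots :: "real \<Rightarrow> complex poly \<Rightarrow> complex poly" where
  "reflect_roots \<rho> p = smult (lead_coeff p) (\<Prod>x\<in>#proots p. reflect_factor \<rho> x)"

lemma norm_poly_reflect_factor_0:
  assumes "\<rho> > 0"
  shows "cmod (poly (reflect_factor \<rho> x) 0) = max \<rho> (cmod x)"
  using assms by (simp add: reflect_factor_def)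

text \<open>On the circle \<open>z * cnj z = \<rho> * \<rho>\<close>, which turns the reflected
  factor into \<open>z * cnj (z - x) / of_real \<rho>\<close>, and \<open>cmod z = \<rho>\<close>
  cancels.\<close>

lemma norm_poly_reflect_factor_circle:
  assumes "\<rho> > 0" "cmod z = \<rho>"
  shows "cmod (poly (reflect_factor \<rho> x) z) = cmod (z - x)"
proof (cases "cmod x < \<rho>")
  case True
  have z: "z * cnj z = of_real \<rho> * of_real \<rho>"
    using assms by (simp add: complex_norm_square[symmetric] power2_eq_square)
  have "poly (reflect_factor \<rho> x) z = of_real \<rho> - cnj x * z / of_real \<rho>"
    using True by (simp add: reflect_factor_def)
  also have "\<dots> = z * cnj (z - x) / of_real \<rho>"
    using z assms by (simp add: field_simps)
  finally show ?thesis
    using assms by (simp add: norm_mult norm_divide flip: complex_cnj_diff)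
qed (simp add: reflect_factor_def norm_minus_commute)

text \<open>A zero of a reflected factor would force \<open>cnj x * z = \<rho> * \<rho>\<close>, too
  large for \<open>cmod x < \<rho>\<close> and \<open>cmod z \<le> \<rho>\<close>. Zeros on the
  circle are excluded because they stay there.\<close>

lemma poly_reflect_factor_nonzero:
  assumes "\<rho> > 0" "cmod z \<le> \<rho>" "cmod x \<noteq> \<rho>"
  shows "poly (reflect_factor \<rho> x) z \<noteq> 0"
proof (cases "cmod x < \<rho>")
  case True
  \<comment> \<open>The strict product inequality needs \<open>cmod z > 0\<close>, so
    \<open>z = 0\<close> is treated apart.\<close>
  have "cmod (cnj x * z) \<noteq> \<rho> * \<rho>"
    using mult_less_le_imp_less[of "cmod x" \<rho> "cmod z" \<rho>] True assms
    by (cases "z = 0") (auto simp: norm_mult)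
  moreover have "cmod (of_real \<rho> * of_real \<rho>) = \<rho> * \<rho>"
    using assms by (simp add: norm_mult)
  ultimately have "cnj x * z \<noteq> of_real \<rho> * of_real \<rho>"
    by metis
  thus ?thesis
    using True assms by (auto simp: reflect_factor_def field_simps)
next
  case False
  thus ?thesis using assms by (auto simp: reflect_factor_def)
qed

lemma norm_poly_prod_mset:
  fixes f :: "'a \<Rightarrow> complex poly"
  shows "cmod (poly (\<Prod>x\<in>#A. f x) z) = (\<Prod>x\<in>#A. cmod (poly (f x) z))"
  by (induction A) (simp_all add: norm_mult)

lemma norm_poly_reflect_roots_0:
  assumes "\<rho> > 0"
  shows "cmod (poly (reflect_roots \<rho> p) 0) = circle_mean \<rho> p"
  using assms
  by (simp add: reflect_roots_def circle_mean_def norm_mult norm_poly_prod_mset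
      norm_poly_reflect_factor_0)

lemma norm_poly_reflect_roots_circle:
  assumes "\<rho> > 0" "cmod z = \<rho>"
  shows "cmod (poly (reflect_roots \<rho> p) z) = cmod (poly p z)"
proof -
  have "cmod (poly (reflect_roots \<rho> p) z) =
      cmod (poly (smult (lead_coeff p) (\<Prod>x\<in>#proots p. [:-x, 1:])) z)"
    using assms
    by (simp add: reflect_roots_def norm_mult norm_poly_prod_mset norm_poly_reflect_factor_circle)
  thus ?thesis by (simp only: complex_poly_decompose_multiset)
qed

lemma poly_reflect_roots_nonzero:
  assumes "\<rho> > 0" "cmod z \<le> \<rho>" "\<And>w. cmod w = \<rho> \<Longrightarrow> poly p w \<noteq> 0"
  shows "poly (reflect_roots \<rho> p) z \<noteq> 0"
proof -
  have p: "p \<noteq> 0"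
    using assms(3)[of "of_real \<rho>"] assms(1) by auto
  have "cmod (poly (reflect_factor \<rho> x) z) \<noteq> 0" if "x \<in># proots p" for x
    using that p assms poly_reflect_factor_nonzero[of \<rho> z x] by auto
  hence "cmod (poly (\<Prod>x\<in>#proots p. reflect_factor \<rho> x) z) \<noteq> 0"
    unfolding norm_poly_prod_mset by (auto simp: prod_mset_zero_iff)
  thus ?thesis using p by (auto simp: reflect_roots_def)
qed

section \<open>Comparison of means by the maximum principle\<close>

text \<open>Only \<open>v\<close> has to be nonzero on the circle: its reflected polynomial is the
  denominator of \<open>f\<close> and must have no zero in the closed disc.\<close>

lemma circle_mean_le:
  assumes \<rho>: "\<rho> > 0"
    and v: "\<And>z. cmod z = \<rho> \<Longrightarrow> poly v z \<noteq> 0"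
    and le: "\<And>z. cmod z = \<rho> \<Longrightarrow> cmod (poly u z) \<le> C * cmod (poly v z)"
  shows "circle_mean \<rho> u \<le> C * circle_mean \<rho> v"
proof -
  define f where "f z = poly (reflect_roots \<rho> u) z / poly (reflect_roots \<rho> v) z" for z
  have nz: "poly (reflect_roots \<rho> v) z \<noteq> 0" if "cmod z \<le> \<rho>" for z
    using poly_reflect_roots_nonzero[OF \<rho> that v] by blast
  have holo: "f holomorphic_on cball 0 \<rho>"
    unfolding f_def using nz by (intro holomorphic_intros) auto
  have "cmod (f 0) \<le> C"
  proof (rule maximum_modulus_frontier[of f "cball 0 \<rho>"])
    show "f holomorphic_on interior (cball 0 \<rho>)"
      by (rule holomorphic_on_subset[OF holo interior_subset])
    show "continuous_on (closure (cball 0 \<rho>)) f"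
      using holomorphic_on_imp_continuous_on[OF holo] by simp
    show "cmod (f z) \<le> C" if "z \<in> frontier (cball 0 \<rho>)" for z
    proof -
      have "cmod z = \<rho>" using that \<rho> by simp
      thus ?thesis
        using le v by (simp add: f_def norm_divide norm_poly_reflect_roots_circle \<rho> divide_le_eq)
    qed
  qed (use \<rho> in auto)
  thus ?thesis
    using nz[of 0] \<rho>
    by (simp add: f_def norm_divide norm_poly_reflect_roots_0 divide_le_eq
        flip: norm_poly_reflect_roots_0)
qed

section \<open>Dependence of the mean on the radius\<close>

lemma circle_mean_pos:
  assumes "\<rho> > 0" "p \<noteq> 0"
  shows "circle_mean \<rho> p > 0"
proof -
  have "(\<Prod>x\<in>#A. max \<rho> (cmod x)) > 0" for A
    using assms by (induction A) (auto intro!: mult_pos_pos simp: less_max_iff_disj)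
  thus ?thesis using assms by (simp add: circle_mean_def)
qed

lemma circle_mean_mono:
  assumes "0 < a" "a \<le> b"
  shows "circle_mean a p \<le> circle_mean b p"
proof -
  have "0 \<le> (\<Prod>x\<in>#A. max a (cmod x)) \<and>
      (\<Prod>x\<in>#A. max a (cmod x)) \<le> (\<Prod>x\<in>#A. max b (cmod x))" for A
    using assms by (induction A) (auto intro!: mult_mono mult_nonneg_nonneg max.mono)
  thus ?thesis by (simp add: circle_mean_def mult_left_mono)
qed

text \<open>Each zero contributes at most one factor \<open>b / a\<close>, which is where the
  exponent of the final bound comes from.\<close>

lemma circle_mean_scale:
  assumes "0 < a" "a \<le> b"
  shows "circle_mean b p \<le> (b / a) ^ degree p * circle_mean a p"
proof -
  have factor: "max b t \<le> (b / a) * max a t" if "t \<ge> 0" for t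
  proof -
    have "b \<le> (b / a) * max a t"
      using mult_left_mono[of a "max a t" "b / a"] assms by simp
    moreover have "t \<le> (b / a) * max a t"
      using mult_mono[of 1 "b / a" t "max a t"] assms that by simp
    ultimately show ?thesis by simp
  qed
  \<comment> \<open>Nonnegativity is carried through the induction as a side condition for
    multiplying inequalities.\<close>
  have "0 \<le> (\<Prod>x\<in>#A. max b (cmod x)) \<and>
      (\<Prod>x\<in>#A. max b (cmod x)) \<le> (b / a) ^ size A * (\<Prod>x\<in>#A. max a (cmod x))" for A
  proof (induction A)
    case (add x A)
    have "max b (cmod x) * (\<Prod>x\<in>#A. max b (cmod x)) \<le>
        (b / a * max a (cmod x)) * ((b / a) ^ size A * (\<Prod>x\<in>#A. max a (cmod x)))"
      using add factor[of "cmod x"] assms by (intro mult_mono) auto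
    thus ?case using add assms by (auto simp: mult_ac max_def)
  qed auto
  from this[of "proots p"] show ?thesis
    by (simp add: circle_mean_def size_proots_complex mult.left_commute mult_left_mono)
qed

lemma annulus_ratio_bound:
  assumes ab: "0 < a" "a < b" and q: "q \<noteq> 0" "degree q \<le> k" and s: "0 \<le> s"
    and p_nz: "\<And>z. cmod z = a \<Longrightarrow> poly p z \<noteq> 0"
    and q_nz: "\<And>z. cmod z = b \<Longrightarrow> poly q z \<noteq> 0"
    and inner: "\<And>z. cmod z = a \<Longrightarrow> i * cmod (poly q z) \<le> cmod (poly p z)"
    and outer: "\<And>z. cmod z = b \<Longrightarrow> cmod (poly p z) \<le> s * cmod (poly q z)"
    and i: "0 < i"
  shows "(a / b) ^ k * i \<le> s"
proof -
  \<comment> \<open>On the inner circle the roles are exchanged: \<open>p\<close> is the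
    denominator, hence \<open>p_nz\<close>.\<close>
  have "circle_mean a q \<le> 1 / i * circle_mean a p"
    using ab p_nz inner i by (intro circle_mean_le) (auto simp: field_simps)
  hence "i * circle_mean a q \<le> circle_mean a p"
    using i by (simp add: field_simps)
  also have "\<dots> \<le> circle_mean b p"
    using ab by (intro circle_mean_mono) auto
  also have "\<dots> \<le> s * circle_mean b q"
    using ab q_nz outer by (intro circle_mean_le) auto
  also have "\<dots> \<le> s * ((b / a) ^ degree q * circle_mean a q)"
    using ab s by (intro mult_left_mono circle_mean_scale) auto
  also have "\<dots> \<le> s * ((b / a) ^ k * circle_mean a q)"
    using ab s q circle_mean_pos[of a q]
    by (intro mult_left_mono mult_right_mono power_increasing) auto
  \<comment> \<open>The positive factor \<open>circle_mean a q\<close> is cancelled from both ends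
    of the chain.\<close>
  finally have "i \<le> s * (b / a) ^ k"
    using circle_mean_pos[OF ab(1) q(1)] by (simp flip: mult.assoc)
  thus ?thesis
    using ab by (simp add: power_divide field_simps)
qed

section \<open>Lower bound for all rational functions\<close>

text \<open>The reduced denominator divides every denominator representing \<open>r\<close>, so the
  degree bound survives reduction to lowest terms.\<close>

lemma ratfuns_quot_of_fractE:
  assumes "r \<in> ratfuns n m"
  obtains p q where "quot_of_fract r = (p, q)" "q \<noteq> 0" "degree q \<le> m"
proof -
  from assms obtain P Q where PQ: "r = Fraction_Field.Fract P Q" "Q \<noteq> 0" "degree Q \<le> m"
    by (auto simp: ratfuns_def)
  have eq: "quot_of_fract r = normalize_quot (P, Q)"
    using quot_of_fract_quot_to_fract[of "(P, Q)"] by (simp add: quot_to_fract_def PQ)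
  obtain d where d: "Q = snd (normalize_quot (P, Q)) * d"
    using normalize_quotE[OF PQ(2), of P] by metis
  have "degree (snd (normalize_quot (P, Q))) \<le> degree Q"
    using PQ(2) d by (intro dvd_imp_degree_le) (auto simp: dvd_def)
  thus ?thesis
    using that[of "fst (normalize_quot (P, Q))" "snd (normalize_quot (P, Q))"] PQ eq by simp
qed

lemma ennreal_le_divide:
  assumes "i \<noteq> 0" "i < \<infinity>" "c * i \<le> (s :: ennreal)"
  shows "c \<le> s / i"
  using assms divide_right_mono_ennreal[of "c * i" s i] by (simp add: ennreal_mult_divide_eq)

lemma zolotarev_quotient_annulus_ge:
  assumes ab: "0 < a" "a < b" and r: "r \<in> ratfuns k k"
  shows "ennreal ((a / b) ^ k) \<le> zolotarev_quotient {z. b \<le> cmod z} {z. cmod z \<le> a} r"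
proof -
  obtain p q where quot: "quot_of_fract r = (p, q)" and q: "q \<noteq> 0" "degree q \<le> k"
    using r by (rule ratfuns_quot_of_fractE)
  define s where "s = (SUP z\<in>{z. b \<le> cmod z}. ratfun_abs r z)"
  define i where "i = (INF z\<in>{z. cmod z \<le> a}. ratfun_abs r z)"
  have abs_eq: "ratfun_abs r z = (if poly q z = 0 then \<infinity> else ennreal (cmod (poly p z / poly q z)))" for z
    by (simp add: ratfun_abs_def quot)
  show ?thesis
  proof (cases "s = \<infinity> \<or> i = 0")
    case True
    thus ?thesis by (simp add: zolotarev_quotient_def s_def i_def)
  next
    case False
    have s_ge: "ratfun_abs r z \<le> s" if "b \<le> cmod z" for z
      unfolding s_def using that by (intro SUP_upper) auto
    have i_le: "i \<le> ratfun_abs r z" if "cmod z \<le> a" for z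
      unfolding i_def using that by (intro INF_lower) auto
    \<comment> \<open>Finiteness of \<open>i\<close> needs a point of the disc that is not a pole;
      the disc is infinite, whereas \<open>q\<close> has finitely many roots.\<close>
    have "infinite (cball (0::complex) a)"
      using uncountable_cball[OF ab(1)] uncountable_infinite by blast
    hence "\<not> cball 0 a \<subseteq> {z. poly q z = 0}"
      using poly_roots_finite[OF q(1)] finite_subset by blast
    then obtain w where "cmod w \<le> a" "poly q w \<noteq> 0" by (auto simp: subset_iff)
    hence i_fin: "i < \<infinity>"
      using i_le[of w] by (auto simp: abs_eq intro: le_less_trans)
    define s' where "s' = enn2real s"
    define i' where "i' = enn2real i"
    have s': "s = ennreal s'" "0 \<le> s'"
      using False by (auto simp: s'_def top.not_eq_extremum)
    have i': "i = ennreal i'" "0 < i'"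
      using False i_fin
      by (auto simp: i'_def enn2real_positive_iff top.not_eq_extremum zero_less_iff_neq_zero)
    have "(a / b) ^ k * i' \<le> s'"
    proof (rule annulus_ratio_bound[OF ab q s'(2)])
      fix z assume z: "cmod z = a"
      have le: "i \<le> ratfun_abs r z" using i_le z by simp
      \<comment> \<open>By coprimality a root of \<open>p\<close> is no pole, so \<open>r\<close>
        would vanish there and \<open>i\<close> would be \<open>0\<close>.\<close>
      show nz: "poly p z \<noteq> 0"
      proof
        assume p0: "poly p z = 0"
        have "coprime p q" using coprime_quot_of_fract[of r] by (simp add: quot)
        hence "poly q z \<noteq> 0"
          using p0 coprime_poly_0 by blast
        thus False using le False p0 by (simp add: abs_eq)
      qed
      \<comment> \<open>At a pole the left side is \<open>0\<close>.\<close>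
      show "i' * cmod (poly q z) \<le> cmod (poly p z)"
        using le i' by (cases "poly q z = 0") (auto simp: abs_eq norm_divide field_simps)
    next
      fix z assume z: "cmod z = b"
      have le: "ratfun_abs r z \<le> s" using s_ge z by simp
      \<comment> \<open>A pole here would make \<open>s\<close> infinite.\<close>
      show nz: "poly q z \<noteq> 0"
        using le False by (auto simp: abs_eq top_unique)
      show "cmod (poly p z) \<le> s' * cmod (poly q z)"
        using le s' nz by (auto simp: abs_eq norm_divide field_simps)
    qed (fact i'(2))
    hence "ennreal ((a / b) ^ k) * i \<le> s"
      using ab i' s' by (simp flip: ennreal_mult)
    hence "ennreal ((a / b) ^ k) \<le> s / i"
      using False i_fin by (intro ennreal_le_divide) auto
    thus ?thesis
      using False by (simp add: zolotarev_quotient_def s_def i_def)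
  qed
qed

section \<open>The extremal function\<close>

text \<open>The pair \<open>(1, monom 1 k)\<close> is coprime with monic denominator, hence already
  the normal form; \<open>0 < k\<close> makes the origin a pole.\<close>

lemma ratfun_abs_inverse_monom:
  assumes "0 < k"
  shows "ratfun_abs (Fraction_Field.Fract 1 (monom 1 k)) z =
    (if z = 0 then \<infinity> else ennreal (1 / cmod z ^ k))"
proof -
  have "(1, monom 1 k :: complex poly) \<in> normalized_fracts"
    by (auto simp: normalized_fracts_def unit_factor_poly_def degree_monom_eq)
  from quot_of_fract_quot_to_fract'[OF this]
  have "quot_of_fract (Fraction_Field.Fract 1 (monom 1 k)) = (1, monom 1 k :: complex poly)"
    by (simp add: quot_to_fract_def)
  thus ?thesis
    using assms by (simp add: ratfun_abs_def poly_monom norm_divide norm_power)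
qed

text \<open>The modulus decreases in \<open>cmod z\<close>, so the supremum is attained at
  \<open>b\<close> and the infimum at \<open>a\<close>; the infinite value at the origin does not
  lower the infimum.\<close>

lemma zolotarev_quotient_inverse_monom:
  assumes ab: "0 < a" "a < b" and k: "0 < k"
  shows "zolotarev_quotient {z. b \<le> cmod z} {z. cmod z \<le> a}
    (Fraction_Field.Fract 1 (monom 1 k)) = ennreal ((a / b) ^ k)"
proof -
  let ?r = "Fraction_Field.Fract 1 (monom 1 k) :: complex poly fract"
  have s: "(SUP z\<in>{z. b \<le> cmod z}. ratfun_abs ?r z) = ennreal (1 / b ^ k)"
  proof (rule antisym)
    show "(SUP z\<in>{z. b \<le> cmod z}. ratfun_abs ?r z) \<le> ennreal (1 / b ^ k)"
      using ab by (intro SUP_least)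
        (auto simp: ratfun_abs_inverse_monom[OF k] intro!: ennreal_leI divide_left_mono power_mono)
    show "ennreal (1 / b ^ k) \<le> (SUP z\<in>{z. b \<le> cmod z}. ratfun_abs ?r z)"
      using ab by (intro SUP_upper2[of "of_real b"]) (auto simp: ratfun_abs_inverse_monom[OF k])
  qed
  have i: "(INF z\<in>{z. cmod z \<le> a}. ratfun_abs ?r z) = ennreal (1 / a ^ k)"
  proof (rule antisym)
    show "ennreal (1 / a ^ k) \<le> (INF z\<in>{z. cmod z \<le> a}. ratfun_abs ?r z)"
      using ab by (intro INF_greatest)
        (auto simp: ratfun_abs_inverse_monom[OF k] intro!: ennreal_leI divide_left_mono power_mono)
    show "(INF z\<in>{z. cmod z \<le> a}. ratfun_abs ?r z) \<le> ennreal (1 / a ^ k)"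
      using ab by (intro INF_lower2[of "of_real a"]) (auto simp: ratfun_abs_inverse_monom[OF k])
  qed
  show ?thesis
    using ab by (simp add: zolotarev_quotient_def s i divide_ennreal power_divide)
qed

theorem theorem4p4:
  fixes a b :: real and k :: nat
  assumes "0 < a" and "a < b" and "0 < k"
  defines "I \<equiv> {z :: complex. cmod z \<le> a}"
    and "O' \<equiv> {z :: complex. b \<le> cmod z}"
    and "r \<equiv> Fraction_Field.Fract 1 (monom 1 k) :: complex poly fract"
  shows "r \<in> ratfuns k k - {0}
    \<and> zolotarev_quotient O' I r = zolotarev k O' I
    \<and> zolotarev k O' I = ennreal ((a / b) ^ k)"
proof -
  have "degree (1 :: complex poly) \<le> k" "degree (monom 1 k :: complex poly) \<le> k"
    by (simp_all add: degree_monom_eq)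
  hence r: "r \<in> ratfuns k k - {0}"
    unfolding r_def ratfuns_def by (fastforce simp: Zero_fract_def eq_fract)
  have quot: "zolotarev_quotient O' I r = ennreal ((a / b) ^ k)"
    unfolding O'_def I_def r_def using assms(1-3) by (rule zolotarev_quotient_inverse_monom)
  have "zolotarev k O' I = ennreal ((a / b) ^ k)"
  proof (rule antisym)
    show "zolotarev k O' I \<le> ennreal ((a / b) ^ k)"
      unfolding zolotarev_def by (rule INF_lower2[OF r]) (simp add: quot)
    show "ennreal ((a / b) ^ k) \<le> zolotarev k O' I"
      unfolding zolotarev_def O'_def I_def
      using assms(1,2) by (intro INF_greatest zolotarev_quotient_annulus_ge) auto
  qed
  with r quot show ?thesis by simp
qed

end
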